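(* Let $S\subset\, ]0,+\infty[$. Then the class $\mathcal{U}^{c<}_S$ of all finite convexly ordered ultrametric spaces with distances in $S$ has the Ramsey property.
   Context: A metric space $X$ is ultrametric when $d^X(x,z)\leqslant\max(d^X(x,y),d^X(y,z))$ for all $x,y,z\in X$. "With distances in $S$" means that all distances between distinct points belong to $S$. A linear ordering $<$ on an ultrametric space $X$ is convex when all the metric balls of $X$ are $<$-convex. $\mathcal{U}^{c<}_S$ is the class of all pairs $(X,<^X)$ where $X$ is a (nonempty) finite ultrametric space with distances in $S$ and $<^X$ is a convex linear ordering on $X$. An isomorphism between ordered metric spaces is an order-preserving bijective isometry, and substructures are subspaces with the restricted ordering; for ordered metric spaces $\mathbf X,\mathbf Z$, $\binom{\mathbf Z}{\mathbf X}$ denotes the set of all substructures of $\mathbf Z$ isomorphic to $\mathbf X$. A class $\mathcal{K}^*$ of finite ordered metric spaces has the Ramsey property when for every $\mathbf X,\mathbf Y\in\mathcal{K}^*$ and every integer $k\geqslant 1$ there is $\mathbf Z\in\mathcal{K}^*$ such that for every map $\chi:\binom{\mathbf Z}{\mathbf X}\to\{0,\dots,k-1\}$ there is $\widetilde{\mathbf Y}\in\binom{\mathbf Z}{\mathbf Y}$ such that $\chi$ is constant on $\binom{\widetilde{\mathbf Y}}{\mathbf X}$. *)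

theory Defs
  imports "HOL-Analysis.Analysis"
begin

text \<open>An ordered metric space: a metric space with explicit carrier, and the strict order
  relation on its points. That the relation is a linear ordering of the carrier is part of the
  definition of \<open>convex_ultrametric_class\<close> below.\<close>

datatype 'a ordered_metric =
  Ordered_Metric (metric_of: "'a metric") (less_of: "'a rel")

abbreviation points :: "'a ordered_metric \<Rightarrow> 'a set"
  where "points X \<equiv> mspace (metric_of X)"

abbreviation distance :: "'a ordered_metric \<Rightarrow> 'a \<Rightarrow> 'a \<Rightarrow> real"
  where "distance X \<equiv> mdist (metric_of X)"

definition substructure :: "'a ordered_metric \<Rightarrow> 'a set \<Rightarrow> 'a ordered_metric"
  where "substructure X A =
    Ordered_Metric (submetric (metric_of X) A) (less_of X \<inter> A \<times> A)"

definition isomorphism :: "('a \<Rightarrow> 'b) \<Rightarrow> 'a ordered_metric \<Rightarrow> 'b ordered_metric \<Rightarrow> bool"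
  where "isomorphism f X Y \<longleftrightarrow>
    bij_betw f (points X) (points Y) \<and>
    (\<forall>x\<in>points X. \<forall>y\<in>points X. distance Y (f x) (f y) = distance X x y) \<and>
    (\<forall>x\<in>points X. \<forall>y\<in>points X. (x, y) \<in> less_of X \<longrightarrow> (f x, f y) \<in> less_of Y)"

definition isomorphic :: "'a ordered_metric \<Rightarrow> 'b ordered_metric \<Rightarrow> bool"
  where "isomorphic X Y \<longleftrightarrow> (\<exists>f. isomorphism f X Y)"

definition copies :: "'a ordered_metric \<Rightarrow> 'b ordered_metric \<Rightarrow> 'a ordered_metric set"
  where "copies Z X = {substructure Z A | A. A \<subseteq> points Z \<and> isomorphic X (substructure Z A)}"

definition ramsey_property :: "'a ordered_metric set \<Rightarrow> bool"
  where "ramsey_property K \<longleftrightarrow>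
    (\<forall>X\<in>K. \<forall>Y\<in>K. \<forall>k\<ge>1. \<exists>Z\<in>K.
      \<forall>\<kappa> :: 'a ordered_metric \<Rightarrow> nat. \<kappa> \<in> copies Z X \<rightarrow> {0..<k} \<longrightarrow>
        (\<exists>Y'\<in>copies Z Y. \<kappa> constant_on copies Y' X))"

definition ultrametric :: "'a metric \<Rightarrow> bool"
  where "ultrametric m \<longleftrightarrow>
    (\<forall>x\<in>mspace m. \<forall>y\<in>mspace m. \<forall>z\<in>mspace m. mdist m x z \<le> max (mdist m x y) (mdist m y z))"

definition distances_in :: "real set \<Rightarrow> 'a metric \<Rightarrow> bool"
  where "distances_in S m \<longleftrightarrow> (\<forall>x\<in>mspace m. \<forall>y\<in>mspace m. x \<noteq> y \<longrightarrow> mdist m x y \<in> S)"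

definition order_convex :: "'a set \<Rightarrow> 'a rel \<Rightarrow> 'a set \<Rightarrow> bool"
  where "order_convex M r A \<longleftrightarrow>
    (\<forall>x\<in>A. \<forall>z\<in>A. \<forall>y\<in>M. (x, y) \<in> r \<and> (y, z) \<in> r \<longrightarrow> y \<in> A)"

text \<open>Both the open and the closed balls are required to be convex; on a finite space the two
  requirements are equivalent.\<close>

definition convex_ordering :: "'a metric \<Rightarrow> 'a rel \<Rightarrow> bool"
  where "convex_ordering m r \<longleftrightarrow>
    (\<forall>x\<in>mspace m. \<forall>\<epsilon>.
      order_convex (mspace m) r (mball_of m x \<epsilon>) \<and> order_convex (mspace m) r (mcball_of m x \<epsilon>))"

text \<open>The inclusion \<open>less_of X \<subseteq> points X \<times> points X\<close> is not implied by
  \<^const>\<open>strict_linear_order_on\<close>.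

  The points are drawn from the type \<open>'a\<close>. If \<open>'a\<close> is infinite, every nonempty finite convexly ordered
  ultrametric space with distances in \<open>S\<close>, on whatever type, is isomorphic to a member of this
  set.\<close>

definition convex_ultrametric_class :: "real set \<Rightarrow> 'a ordered_metric set"
  where "convex_ultrametric_class S = {X.
    finite (points X) \<and> points X \<noteq> {} \<and>
    ultrametric (metric_of X) \<and> distances_in S (metric_of X) \<and>
    less_of X \<subseteq> points X \<times> points X \<and> strict_linear_order_on (points X) (less_of X) \<and>
    convex_ordering (metric_of X) (less_of X)}"

end

theory Submission
  imports Defs "HOL-Library.Ramsey"
begin

text \<open>
  The distances of \<open>X\<close> and \<open>Y\<close> form a finite set \<open>D\<close>. An ultrametric space with distances in \<open>D\<close>
  is the set of leaves of a tree: its nodes are the pairs \<open>(B, d)\<close> with \<open>d \<in> D\<close> and \<open>B\<close> an open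
  ball of radius \<open>d\<close>, and a leaf \<open>x\<close> is determined by its branch, the nodes \<open>(ball x d, d)\<close>. A
  convex ordering also orders the balls of each fixed radius. If the nodes carry natural numbers
  that increase with this order on every level, then reading the numbers along the branches turns
  the points into functions \<open>D \<Rightarrow> nat\<close>. Two such functions last differ (for the order of \<open>D\<close>) at the
  distance of the two points, and the values there are ordered as the points are. So the space
  becomes a subspace of the cube of all functions \<open>D \<Rightarrow> {..R}\<close>, with the last difference as
  distance and with the lexicographic ordering. The cube is itself a finite convexly ordered
  ultrametric space with distances in \<open>D\<close>, and it is the space \<open>Z\<close>.

  Now order all nodes linearly, first by level and then by the order of the balls. Every embedding
  \<open>e\<close> of \<open>X\<close> into \<open>Y\<close> maps the nodes of \<open>X\<close> to the nodes of \<open>Y\<close> by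
  \<open>(ball x d, d) \<mapsto> (ball (e x) d, d)\<close>, and this map is strictly increasing, because the order of two
  nodes is decided by their levels and by the distance and the order of points in them, all of
  which \<open>e\<close> preserves. Restrict attention to labellings that are strictly increasing for this linear
  order. Such a labelling is determined by its set of labels: each set \<open>H\<close> of as many numbers as
  \<open>Y\<close> has nodes yields one copy \<open>Y\<^sub>H\<close> of \<open>Y\<close> in the cube. Every copy of \<open>X\<close> inside \<open>Y\<^sub>H\<close> inherits a
  strictly increasing labelling with labels in \<open>H\<close>, hence is \<open>X\<^sub>J\<close> for some \<open>J \<subseteq> H\<close>
  (\<open>copy_inside_labelled_image\<close>). A colouring of the copies of \<open>X\<close> thus colours sets \<open>J\<close> of fixed
  size, and Ramsey's theorem provides an \<open>H\<close> such that all these \<open>J \<subseteq> H\<close> have one colour.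
\<close>

section \<open>Convexly ordered ultrametric spaces\<close>

lemma class_carrier:
  assumes "W \<in> convex_ultrametric_class S"
  shows "finite (points W)" "points W \<noteq> {}"
    "\<And>x y. x \<in> points W \<Longrightarrow> y \<in> points W \<Longrightarrow> x \<noteq> y \<Longrightarrow> distance W x y \<in> S"
  using assms by (auto simp: convex_ultrametric_class_def distances_in_def)

lemma class_order:
  assumes "W \<in> convex_ultrametric_class S"
  shows "\<And>x y z. (x, y) \<in> less_of W \<Longrightarrow> (y, z) \<in> less_of W \<Longrightarrow> (x, z) \<in> less_of W"
    and "\<And>x. (x, x) \<notin> less_of W"
    and "\<And>x y. x \<in> points W \<Longrightarrow> y \<in> points W \<Longrightarrow> x \<noteq> y \<Longrightarrow> (x, y) \<in> less_of W \<or> (y, x) \<in> less_of W"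
    and "\<And>x y. (x, y) \<in> less_of W \<Longrightarrow> x \<in> points W \<and> y \<in> points W"
proof -
  have "trans (less_of W)" "irrefl (less_of W)"
    and total: "\<And>x y. x \<in> points W \<Longrightarrow> y \<in> points W \<Longrightarrow> x \<noteq> y \<Longrightarrow> (x, y) \<in> less_of W \<or> (y, x) \<in> less_of W"
    and "less_of W \<subseteq> points W \<times> points W"
    using assms by (auto simp: convex_ultrametric_class_def strict_linear_order_on_def total_on_def)
  then show "\<And>x y z. (x, y) \<in> less_of W \<Longrightarrow> (y, z) \<in> less_of W \<Longrightarrow> (x, z) \<in> less_of W"
    "\<And>x. (x, x) \<notin> less_of W"
    "\<And>x y. x \<in> points W \<Longrightarrow> y \<in> points W \<Longrightarrow> x \<noteq> y \<Longrightarrow> (x, y) \<in> less_of W \<or> (y, x) \<in> less_of W"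
    "\<And>x y. (x, y) \<in> less_of W \<Longrightarrow> x \<in> points W \<and> y \<in> points W"
    by (blast dest: transD irreflD)+
qed

lemma class_ultrametric:
  assumes "W \<in> convex_ultrametric_class S" "x \<in> points W" "y \<in> points W" "z \<in> points W"
  shows "distance W x z \<le> max (distance W x y) (distance W y z)"
  using assms by (auto simp: convex_ultrametric_class_def ultrametric_def)

lemma distance_commute: "distance W x y = distance W y x"
  by (rule Metric_space.commute[OF Metric_space_mspace_mdist])

lemma distance_self: "x \<in> points W \<Longrightarrow> distance W x x = 0"
  by (simp add: Metric_space.zero[OF Metric_space_mspace_mdist])

text \<open>Convexity of the closed balls of radius \<open>distance W x z\<close> around \<open>x\<close> and around \<open>z\<close>.\<close>

lemma distance_between_le:
  assumes W: "W \<in> convex_ultrametric_class S" and xy: "(x, y) \<in> less_of W" and yz: "(y, z) \<in> less_of W"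
  shows "distance W x y \<le> distance W x z" "distance W y z \<le> distance W x z"
proof -
  have pts: "x \<in> points W" "y \<in> points W" "z \<in> points W"
    using class_order(4)[OF W xy] class_order(4)[OF W yz] by auto
  have convex: "order_convex (points W) (less_of W) (mcball_of (metric_of W) c r)"
    if "c \<in> points W" for c r
    using W that by (auto simp: convex_ultrametric_class_def convex_ordering_def)
  have "y \<in> mcball_of (metric_of W) c (distance W x z)" if "c = x \<or> c = z" for c
  proof -
    have "x \<in> mcball_of (metric_of W) c (distance W x z)" "z \<in> mcball_of (metric_of W) c (distance W x z)"
      using pts that by (auto simp: distance_self distance_commute
          Metric_space.nonneg[OF Metric_space_mspace_mdist])
    then show ?thesis
      using convex[of c "distance W x z"] that pts xy yz unfolding order_convex_def by blast
  qed
  from this[of x] this[of z] show "distance W x y \<le> distance W x z" "distance W y z \<le> distance W x z"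
    by (auto simp: distance_commute)
qed

section \<open>The linear order of the nodes\<close>

text \<open>The number of pairs \<open>(y, d')\<close> whose node precedes the node \<open>(ball x d, d)\<close>: either it lies on a
  lower level, or it is a ball of the same radius that lies to the left. By convexity a disjoint
  ball lies to the left as soon as one of its points does, so no minima of balls are needed.\<close>

definition level_rank :: "real set \<Rightarrow> 'b ordered_metric \<Rightarrow> 'b \<Rightarrow> real \<Rightarrow> nat"
  where "level_rank D W x d =
    card (points W \<times> {d'\<in>D. d' < d} \<union> {y. (y, x) \<in> less_of W \<and> d \<le> distance W y x} \<times> {d})"

definition node_ranks :: "real set \<Rightarrow> 'b ordered_metric \<Rightarrow> nat set"
  where "node_ranks D W = (\<lambda>(x, d). level_rank D W x d) ` (points W \<times> D)"

lemma level_rank_in_node_ranks: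
  "x \<in> points W \<Longrightarrow> d \<in> D \<Longrightarrow> level_rank D W x d \<in> node_ranks D W"
  unfolding node_ranks_def by (rule image_eqI[of _ _ "(x, d)"]) auto

lemma finite_node_ranks:
  "W \<in> convex_ultrametric_class S \<Longrightarrow> finite D \<Longrightarrow> finite (node_ranks D W)"
  by (auto simp: node_ranks_def class_carrier)

lemma finite_earlier_nodes:
  assumes "W \<in> convex_ultrametric_class S" "finite D"
  shows "finite (points W \<times> {d'\<in>D. d' < d} \<union> {y. (y, x) \<in> less_of W \<and> d \<le> distance W y x} \<times> {d})"
proof -
  have "{y. (y, x) \<in> less_of W \<and> d \<le> distance W y x} \<subseteq> points W"
    using class_order(4)[OF assms(1)] by blast
  then show ?thesis
    using assms class_carrier(1)[OF assms(1)] by (auto intro: finite_subset)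
qed

text \<open>Convexity keeps a point outside the ball of radius \<open>d\<close> around \<open>x\<close> on one side of the whole ball,
  and the ultrametric inequality makes the condition of lying outside independent of the centre.\<close>

lemma far_predecessor_of_near:
  assumes W: "W \<in> convex_ultrametric_class S"
    and pts: "x \<in> points W" "x' \<in> points W" and near: "distance W x x' < d"
    and y: "(y, x) \<in> less_of W" "d \<le> distance W y x"
  shows "(y, x') \<in> less_of W \<and> d \<le> distance W y x'"
proof -
  have yW: "y \<in> points W" using class_order(4)[OF W y(1)] by blast
  have far: "d \<le> distance W y x'"
    using class_ultrametric[OF W yW pts(2) pts(1)] near y(2) distance_commute[of W x x'] by auto
  have "(x', y) \<notin> less_of W"
    using distance_between_le(2)[OF W _ y(1), of x'] near y(2) distance_commute[of W x x'] by auto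
  moreover have "y \<noteq> x'" using near y(2) distance_commute[of W x x'] by auto
  ultimately show ?thesis using far class_order(3)[OF W yW pts(2)] by blast
qed

lemma level_rank_eq_if_near:
  assumes "W \<in> convex_ultrametric_class S" "x \<in> points W" "x' \<in> points W" "distance W x x' < d"
  shows "level_rank D W x d = level_rank D W x' d"
proof -
  have "{y. (y, x) \<in> less_of W \<and> d \<le> distance W y x} = {y. (y, x') \<in> less_of W \<and> d \<le> distance W y x'}"
    using far_predecessor_of_near[OF assms]
      far_predecessor_of_near[OF assms(1,3,2) assms(4)[folded distance_commute[of W x']]] by blast
  then show ?thesis by (simp add: level_rank_def)
qed

lemma level_rank_less_if_lower:
  assumes W: "W \<in> convex_ultrametric_class S" and "finite D"
    and "x \<in> points W" "x' \<in> points W" "d \<in> D" "d < d'"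
  shows "level_rank D W x d < level_rank D W x' d'"
  unfolding level_rank_def
proof (rule psubset_card_mono[OF finite_earlier_nodes[OF assms(1,2)]], rule psubsetI)
  let ?A = "\<lambda>x d. points W \<times> {d'\<in>D. d' < d} \<union> {y. (y, x) \<in> less_of W \<and> d \<le> distance W y x} \<times> {d}"
  show "?A x d \<subseteq> ?A x' d'" using assms class_order(4)[OF W] by auto
  have "(x, d) \<in> ?A x' d'" "(x, d) \<notin> ?A x d" using assms class_order(2)[OF W] by auto
  then show "?A x d \<noteq> ?A x' d'" by blast
qed

lemma level_rank_less_if_left:
  assumes W: "W \<in> convex_ultrametric_class S" and "finite D"
    and less: "(x, x') \<in> less_of W" and far: "d \<le> distance W x x'"
  shows "level_rank D W x d < level_rank D W x' d"
  unfolding level_rank_def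
proof (rule psubset_card_mono[OF finite_earlier_nodes[OF assms(1,2)]], rule psubsetI)
  let ?A = "\<lambda>x. points W \<times> {d'\<in>D. d' < d} \<union> {y. (y, x) \<in> less_of W \<and> d \<le> distance W y x} \<times> {d}"
  show "?A x \<subseteq> ?A x'"
    using distance_between_le(2)[OF W _ less] class_order(1)[OF W _ less] far by fastforce
  have "(x, d) \<in> ?A x'" "(x, d) \<notin> ?A x" using less far class_order(2)[OF W] by auto
  then show "?A x \<noteq> ?A x'" by blast
qed

lemma level_rank_less_iff:
  assumes W: "W \<in> convex_ultrametric_class S" and "finite D"
    and "x \<in> points W" "x' \<in> points W" "d \<in> D" "d' \<in> D"
  shows "level_rank D W x d < level_rank D W x' d' \<longleftrightarrow>
    d < d' \<or> d = d' \<and> (x, x') \<in> less_of W \<and> d \<le> distance W x x'"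
proof -
  consider "d < d'" | "d' < d" | "d = d'" "distance W x x' < d" | "d = d'" "x = x'"
    | "d = d'" "(x, x') \<in> less_of W" "d \<le> distance W x x'"
    | "d = d'" "(x', x) \<in> less_of W" "d \<le> distance W x x'"
    using class_order(3)[OF W assms(3,4)] by fastforce
  then show ?thesis
  proof cases
    case 1 then show ?thesis using level_rank_less_if_lower[OF assms(1-4)] assms by auto
  next
    case 2 then show ?thesis using level_rank_less_if_lower[OF assms(1,2,4,3)] assms by force
  next
    case 3 then show ?thesis using level_rank_eq_if_near[OF assms(1,3,4)] by auto
  next
    case 4 then show ?thesis using class_order(2)[OF W] by auto
  next
    case 5 then show ?thesis using level_rank_less_if_left[OF assms(1,2)] by auto
  next
    case 6
    then have "level_rank D W x' d < level_rank D W x d"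
      using level_rank_less_if_left[OF assms(1,2)] distance_commute[of W x x'] by auto
    moreover have "(x, x') \<notin> less_of W" using 6 class_order(1,2)[OF W] by blast
    ultimately show ?thesis using 6 by auto
  qed
qed

text \<open>The right-hand side of the comparison of ranks mentions only levels, distances and the order of
  points, so an embedding carries the ranks of \<open>X\<close> to those of \<open>Y\<close> by a strictly increasing map.\<close>

lemma embedding_of_node_ranks:
  assumes X: "X \<in> convex_ultrametric_class S" and Y: "Y \<in> convex_ultrametric_class S'"
    and D: "finite D"
    and e: "\<And>x. x \<in> points X \<Longrightarrow> e x \<in> points Y"
    and dist: "\<And>x y. x \<in> points X \<Longrightarrow> y \<in> points X \<Longrightarrow> distance Y (e x) (e y) = distance X x y"
    and less: "\<And>x y. (x, y) \<in> less_of X \<longleftrightarrow> x \<in> points X \<and> y \<in> points X \<and> (e x, e y) \<in> less_of Y"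
  obtains \<phi> where "strict_mono_on (node_ranks D X) \<phi>"
    "\<And>x d. x \<in> points X \<Longrightarrow> d \<in> D \<Longrightarrow> \<phi> (level_rank D X x d) = level_rank D Y (e x) d"
proof -
  have lt: "level_rank D X x d < level_rank D X x' d' \<longleftrightarrow>
      level_rank D Y (e x) d < level_rank D Y (e x') d'"
    if "x \<in> points X" "x' \<in> points X" "d \<in> D" "d' \<in> D" for x x' d d'
    using that level_rank_less_iff[OF X D] level_rank_less_iff[OF Y D] e dist less by auto
  then have eq: "level_rank D Y (e x) d = level_rank D Y (e x') d'"
    if "x \<in> points X" "x' \<in> points X" "d \<in> D" "d' \<in> D"
      "level_rank D X x d = level_rank D X x' d'" for x x' d d'
    using that by (metis linorder_less_linear less_irrefl)
  \<comment> \<open>Any representative of a node serves, since equal ranks in \<open>X\<close> give equal ranks in \<open>Y\<close>.\<close>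
  define node where "node k = (SOME u. u \<in> points X \<times> D \<and> level_rank D X (fst u) (snd u) = k)" for k
  define \<phi> where "\<phi> k = level_rank D Y (e (fst (node k))) (snd (node k))" for k
  have phi: "\<phi> (level_rank D X x d) = level_rank D Y (e x) d" if "x \<in> points X" "d \<in> D" for x d
  proof -
    have "node (level_rank D X x d) \<in> points X \<times> D \<and>
      level_rank D X (fst (node (level_rank D X x d))) (snd (node (level_rank D X x d))) = level_rank D X x d"
      unfolding node_def by (rule someI[of _ "(x, d)"]) (use that in auto)
    then show ?thesis unfolding \<phi>_def using that by (intro eq) auto
  qed
  have "strict_mono_on (node_ranks D X) \<phi>"
    by (rule strict_mono_onI) (auto simp: node_ranks_def phi lt)
  then show thesis using that phi by blast
qed

section \<open>Increasing labellings of finite sets of numbers\<close>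

text \<open>The value at \<open>k\<close> is the element of the image that has as many elements of the image below it as
  \<open>k\<close> has elements of \<open>N\<close> below it.\<close>

lemma strict_mono_on_eq_if_image_eq:
  fixes f g :: "'b::linorder \<Rightarrow> 'c::linorder"
  assumes "finite N" "strict_mono_on N f" "strict_mono_on N g" "f ` N = g ` N" "k \<in> N"
  shows "f k = g k"
proof -
  have count: "card {h \<in> l ` N. h < l k} = card {i \<in> N. i < k}" if l: "strict_mono_on N l" for l :: "'b \<Rightarrow> 'c"
  proof -
    have "{h \<in> l ` N. h < l k} = l ` {i \<in> N. i < k}"
      using l \<open>k \<in> N\<close> by (auto simp: strict_mono_on_less)
    moreover have "inj_on l {i \<in> N. i < k}"
      using strict_mono_on_imp_inj_on[OF l] by (auto intro: inj_on_subset)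
    ultimately show ?thesis by (simp add: card_image)
  qed
  have less: "card {h \<in> f ` N. h < a} < card {h \<in> f ` N. h < b}" if "a < b" "a \<in> f ` N" for a b
    by (rule psubset_card_mono) (use that \<open>finite N\<close> in auto)
  have "card {h \<in> f ` N. h < f k} = card {h \<in> f ` N. h < g k}"
    using count[OF assms(2)] count[OF assms(3)] assms(4) by simp
  moreover have "f k \<in> f ` N" "g k \<in> f ` N"
    using \<open>k \<in> N\<close> assms(4) by auto
  ultimately show ?thesis
    using less[of "f k" "g k"] less[of "g k" "f k"] by (cases "f k" "g k" rule: linorder_cases) simp_all
qed

lemma increasing_labelling_exists:
  fixes N H :: "nat set"
  assumes "finite N" "finite H" "card N = card H"
  shows "\<exists>l. strict_mono_on N l \<and> l ` N = H"
proof -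
  obtain f where f: "bij_betw f {..<card N} N" "strict_mono_on {..<card N} f"
    using ex_bij_betw_strict_mono_card[OF \<open>finite N\<close>] .
  obtain g where g: "bij_betw g {..<card N} H" "strict_mono_on {..<card N} g"
    using ex_bij_betw_strict_mono_card[OF \<open>finite H\<close>] assms(3) by metis
  define l where "l = g \<circ> inv_into {..<card N} f"
  have lf: "l (f i) = g i" if "i < card N" for i
    using f(1) that by (simp add: l_def bij_betw_inv_into_left)
  have N: "N = f ` {..<card N}" using f(1) by (simp add: bij_betw_def)
  have "strict_mono_on N l"
    by (subst N, rule strict_mono_onI)
      (use f(2) g(2) in \<open>auto simp: lf strict_mono_on_less\<close>)
  moreover have "l ` N = H"
    by (subst N) (use g(1) in \<open>auto simp: lf image_image bij_betw_def\<close>)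
  ultimately show ?thesis by blast
qed

definition increasing_labelling :: "nat set \<Rightarrow> nat set \<Rightarrow> nat \<Rightarrow> nat"
  where "increasing_labelling N H = (SOME l. strict_mono_on N l \<and> l ` N = H)"

lemma increasing_labelling:
  assumes "finite N" "finite H" "card N = card H"
  shows "strict_mono_on N (increasing_labelling N H)" "increasing_labelling N H ` N = H"
  using someI_ex[OF increasing_labelling_exists[OF assms]] by (auto simp: increasing_labelling_def)

section \<open>The lexicographically ordered cube\<close>

text \<open>The largest place at which \<open>f\<close> and \<open>g\<close> differ. The inserted \<open>0\<close> is the distance of a point to
  itself.\<close>

definition last_difference :: "real set \<Rightarrow> (real \<Rightarrow> nat) \<Rightarrow> (real \<Rightarrow> nat) \<Rightarrow> real"
  where "last_difference D f g = Max (insert 0 {d\<in>D. f d \<noteq> g d})"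

definition lex_less :: "real set \<Rightarrow> (real \<Rightarrow> nat) \<Rightarrow> (real \<Rightarrow> nat) \<Rightarrow> bool"
  where "lex_less D f g \<longleftrightarrow> (\<exists>d\<in>D. f d < g d \<and> (\<forall>d'\<in>D. d < d' \<longrightarrow> f d' = g d'))"

text \<open>The points of the cube are taken from an arbitrary set \<open>M\<close> with a bijection \<open>code\<close> onto the
  functions, since the Ramsey property asks for a space on a given type.\<close>

locale lexicographic_cube =
  fixes D :: "real set" and R :: nat and M :: "'a set" and code :: "'a \<Rightarrow> real \<Rightarrow> nat"
  assumes finite_D: "finite D" and D_pos: "D \<subseteq> {0<..}"
    and code_bij: "bij_betw code M (D \<rightarrow>\<^sub>E {..R})"
begin

lemma last_difference_nonneg: "0 \<le> last_difference D f g"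
  using finite_D by (simp add: last_difference_def)

lemma last_difference_commute: "last_difference D f g = last_difference D g f"
  by (simp add: last_difference_def eq_commute)

lemma last_difference_eqI:
  assumes "d \<in> D" "f d \<noteq> g d" "\<And>d'. d' \<in> D \<Longrightarrow> d < d' \<Longrightarrow> f d' = g d'"
  shows "last_difference D f g = d"
  unfolding last_difference_def
  by (rule Max_eqI) (use assms finite_D D_pos in \<open>force simp: not_le[symmetric]\<close>)+

lemma last_difference_ultrametric:
  "last_difference D f h \<le> max (last_difference D f g) (last_difference D g h)"
proof -
  have "d \<le> max (last_difference D f g) (last_difference D g h)" if "d \<in> insert 0 {d\<in>D. f d \<noteq> h d}" for d
  proof -
    have "d \<in> insert 0 {d\<in>D. f d \<noteq> g d} \<or> d \<in> insert 0 {d\<in>D. g d \<noteq> h d}" using that by auto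
    then show ?thesis unfolding last_difference_def using finite_D by (auto simp: le_max_iff_disj)
  qed
  then show ?thesis unfolding last_difference_def[of D f h] using finite_D by simp
qed

lemma exists_last_difference:
  assumes "\<exists>d\<in>D. f d \<noteq> g d"
  obtains d where "d \<in> D" "f d \<noteq> g d" "\<And>d'. d' \<in> D \<Longrightarrow> d < d' \<Longrightarrow> f d' = g d'"
    "last_difference D f g = d"
proof -
  let ?E = "{d\<in>D. f d \<noteq> g d}"
  have E: "finite ?E" "?E \<noteq> {}" using finite_D assms by auto
  have "Max ?E \<in> ?E" using Max_in[OF E] .
  moreover have "f d' = g d'" if "d' \<in> D" "Max ?E < d'" for d'
    using that Max_ge[OF E(1), of d'] by auto
  ultimately show thesis using that[of "Max ?E"] last_difference_eqI[of "Max ?E" f g] by blast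
qed

lemma code_eq_iff: "a \<in> M \<Longrightarrow> b \<in> M \<Longrightarrow> a = b \<longleftrightarrow> (\<forall>d\<in>D. code a d = code b d)"
proof -
  assume ab: "a \<in> M" "b \<in> M"
  then have "code a \<in> D \<rightarrow>\<^sub>E {..R}" "code b \<in> D \<rightarrow>\<^sub>E {..R}"
    using code_bij by (auto simp: bij_betw_def)
  then have "code a = code b" if "\<forall>d\<in>D. code a d = code b d"
    using that by (intro PiE_ext) auto
  then show ?thesis using ab code_bij by (auto simp: bij_betw_def inj_on_def)
qed

lemma finite_M: "finite M"
  using bij_betw_finite[OF code_bij] finite_PiE[OF finite_D, of "\<lambda>_. {..R}"] by simp

lemma M_nonempty: "M \<noteq> {}"
proof -
  have "(D \<rightarrow>\<^sub>E {..R}) \<noteq> {}" by (simp add: PiE_eq_empty_iff)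
  then show ?thesis using code_bij by (auto simp: bij_betw_def)
qed

lemma exists_last_difference_code:
  assumes "a \<in> M" "b \<in> M" "a \<noteq> b"
  obtains d where "d \<in> D" "code a d \<noteq> code b d" "\<And>d'. d' \<in> D \<Longrightarrow> d < d' \<Longrightarrow> code a d' = code b d'"
    "last_difference D (code a) (code b) = d"
  using exists_last_difference[of "code a" "code b"] code_eq_iff[OF assms(1,2)] assms(3) by blast

lemma metric_space: "Metric_space M (\<lambda>a b. last_difference D (code a) (code b))"
proof
  fix a b c assume M: "a \<in> M" "b \<in> M"
  show "(last_difference D (code a) (code b) = 0) = (a = b)"
  proof
    assume "last_difference D (code a) (code b) = 0"
    then show "a = b"
      using exists_last_difference_code[OF M, of "a = b"] D_pos by (metis greaterThan_iff less_irrefl subsetD)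
  qed (simp add: last_difference_def)
  show "last_difference D (code a) (code c) \<le>
      last_difference D (code a) (code b) + last_difference D (code b) (code c)"
    using last_difference_ultrametric[of "code a" "code c" "code b"]
      last_difference_nonneg[of "code a" "code b"] last_difference_nonneg[of "code b" "code c"] by linarith
qed (simp_all add: last_difference_nonneg last_difference_commute)

definition cube :: "'a ordered_metric"
  where "cube = Ordered_Metric (metric (M, \<lambda>a b. last_difference D (code a) (code b)))
    {(a, b). a \<in> M \<and> b \<in> M \<and> lex_less D (code a) (code b)}"

lemma points_cube [simp]: "points cube = M"
  and distance_cube [simp]: "distance cube a b = last_difference D (code a) (code b)"
  and less_cube [simp]: "(a, b) \<in> less_of cube \<longleftrightarrow> a \<in> M \<and> b \<in> M \<and> lex_less D (code a) (code b)"
  using Metric_space.mspace_metric[OF metric_space] Metric_space.mdist_metric[OF metric_space]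
  by (simp_all add: cube_def)

text \<open>If \<open>f\<close> and \<open>g\<close> last differ at \<open>d\<^sub>1\<close>, and \<open>g\<close> and \<open>h\<close> at \<open>d\<^sub>2\<close>, then \<open>f\<close> and \<open>h\<close> last differ at
  \<open>max d\<^sub>1 d\<^sub>2\<close>: both steps go up, so nothing cancels there.\<close>

lemma lex_less_trans:
  assumes "lex_less D f g" "lex_less D g h"
  shows "lex_less D f h" "last_difference D f g \<le> last_difference D f h"
proof -
  obtain d where d: "d \<in> D" "f d < g d" "\<And>d'. d' \<in> D \<Longrightarrow> d < d' \<Longrightarrow> f d' = g d'"
    using assms(1) unfolding lex_less_def by blast
  obtain e where e: "e \<in> D" "g e < h e" "\<And>d'. d' \<in> D \<Longrightarrow> e < d' \<Longrightarrow> g d' = h d'"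
    using assms(2) unfolding lex_less_def by blast
  have m: "max d e \<in> D" "f (max d e) < h (max d e)"
    "\<And>d'. d' \<in> D \<Longrightarrow> max d e < d' \<Longrightarrow> f d' = h d'"
    using d e by (cases d e rule: linorder_cases; force simp: max_def)+
  then show "lex_less D f h" unfolding lex_less_def by blast
  have "last_difference D f g = d" using d by (intro last_difference_eqI) auto
  moreover have "last_difference D f h = max d e" using m by (intro last_difference_eqI) auto
  ultimately show "last_difference D f g \<le> last_difference D f h" by simp
qed

lemma cube_in_class: "cube \<in> convex_ultrametric_class D"
proof -
  have ultra: "ultrametric (metric_of cube)"
    using last_difference_ultrametric by (auto simp: ultrametric_def)
  have dist: "distances_in D (metric_of cube)"
    unfolding distances_in_def using exists_last_difference_code by (metis points_cube distance_cube)
  have total: "lex_less D (code a) (code b) \<or> lex_less D (code b) (code a)"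
    if "a \<in> M" "b \<in> M" "a \<noteq> b" for a b
    by (rule exists_last_difference_code[OF that]) (metis lex_less_def linorder_neqE_nat)
  have "trans (less_of cube)" using lex_less_trans(1) by (fastforce intro: transI)
  moreover have "irrefl (less_of cube)" by (auto simp: irrefl_def lex_less_def)
  moreover have "total_on (points cube) (less_of cube)" using total by (auto simp: total_on_def)
  ultimately have lin: "strict_linear_order_on (points cube) (less_of cube)"
    by (simp add: strict_linear_order_on_def)
  have between: "last_difference D (code c) (code y) \<le>
      max (last_difference D (code c) (code x)) (last_difference D (code c) (code z))"
    if "lex_less D (code x) (code y)" "lex_less D (code y) (code z)" for c x y z
    using lex_less_trans(2)[OF that] last_difference_ultrametric[of "code c" "code y" "code x"]
      last_difference_ultrametric[of "code x" "code z" "code c"]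
      last_difference_commute[of "code c" "code x"] by linarith
  have conv: "convex_ordering (metric_of cube) (less_of cube)"
    unfolding convex_ordering_def order_convex_def
  proof (intro ballI allI conjI impI; clarsimp)
    fix c r x y z
    assume less: "lex_less D (code x) (code y)" "lex_less D (code y) (code z)"
    show "last_difference D (code c) (code y) < r"
      if "last_difference D (code c) (code x) < r" "last_difference D (code c) (code z) < r"
      using that between[OF less, of c] by simp
    show "last_difference D (code c) (code y) \<le> r"
      if "last_difference D (code c) (code x) \<le> r" "last_difference D (code c) (code z) \<le> r"
      using that between[OF less, of c] by simp
  qed
  show ?thesis
    unfolding convex_ultrametric_class_def
    using finite_M M_nonempty ultra dist lin conv by auto
qed

section \<open>Copies given by labellings\<close>

definition branch :: "'b ordered_metric \<Rightarrow> (nat \<Rightarrow> nat) \<Rightarrow> 'b \<Rightarrow> real \<Rightarrow> nat"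
  where "branch W l w = (\<lambda>d\<in>D. l (level_rank D W w d))"

definition labelled_point :: "'b ordered_metric \<Rightarrow> (nat \<Rightarrow> nat) \<Rightarrow> 'b \<Rightarrow> 'a"
  where "labelled_point W l w = inv_into M code (branch W l w)"

lemma labelled_point:
  assumes "l ` node_ranks D W \<subseteq> {..R}" "w \<in> points W"
  shows "labelled_point W l w \<in> M" "code (labelled_point W l w) = branch W l w"
proof -
  have "branch W l w \<in> D \<rightarrow>\<^sub>E {..R}"
    using assms by (auto simp: branch_def node_ranks_def image_subset_iff)
  then have *: "branch W l w \<in> code ` M" using code_bij by (auto simp: bij_betw_def)
  show "labelled_point W l w \<in> M" unfolding labelled_point_def by (rule inv_into_into[OF *])
  show "code (labelled_point W l w) = branch W l w"
    unfolding labelled_point_def by (rule f_inv_into_f[OF *])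
qed

text \<open>The branches of \<open>v\<close> and \<open>w\<close> agree above \<open>d = distance W v w\<close>, where the balls around \<open>v\<close> and \<open>w\<close>
  coincide. The open balls of radius \<open>d\<close> are disjoint and ordered as \<open>v\<close> and \<open>w\<close> are, hence so are
  the labels.\<close>

lemma branches_of_ordered_points:
  assumes W: "W \<in> convex_ultrametric_class D" and l: "strict_mono_on (node_ranks D W) l"
    and vw: "(v, w) \<in> less_of W"
  shows "last_difference D (branch W l v) (branch W l w) = distance W v w"
    "lex_less D (branch W l v) (branch W l w)"
proof -
  let ?d = "distance W v w"
  have pts: "v \<in> points W" "w \<in> points W" "v \<noteq> w"
    using class_order(2,4)[OF W] vw by auto
  have d: "?d \<in> D" using class_carrier(3)[OF W pts] .
  have ranks: "level_rank D W u ?d \<in> node_ranks D W" if "u \<in> points W" for u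
    using that d by (auto simp: node_ranks_def)
  have lt: "branch W l v ?d < branch W l w ?d"
    using level_rank_less_if_left[OF W finite_D vw order_refl] strict_mono_onD[OF l] ranks pts d
    by (auto simp: branch_def)
  have eq: "branch W l v d' = branch W l w d'" if "d' \<in> D" "?d < d'" for d'
    using level_rank_eq_if_near[OF W pts(1,2) that(2)] by (simp add: branch_def)
  show "last_difference D (branch W l v) (branch W l w) = ?d"
    using d lt eq by (intro last_difference_eqI) auto
  show "lex_less D (branch W l v) (branch W l w)"
    unfolding lex_less_def using d lt eq by blast
qed

lemma labelled_point_embedding:
  assumes W: "W \<in> convex_ultrametric_class D" and l: "strict_mono_on (node_ranks D W) l"
    and R: "l ` node_ranks D W \<subseteq> {..R}"
  shows "\<And>v w. v \<in> points W \<Longrightarrow> w \<in> points W \<Longrightarrow>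
      distance cube (labelled_point W l v) (labelled_point W l w) = distance W v w"
    and "\<And>v w. (v, w) \<in> less_of W \<Longrightarrow> (labelled_point W l v, labelled_point W l w) \<in> less_of cube"
    and "inj_on (labelled_point W l) (points W)"
proof -
  note p = labelled_point[OF R]
  show dist: "distance cube (labelled_point W l v) (labelled_point W l w) = distance W v w"
    if pts: "v \<in> points W" "w \<in> points W" for v w
  proof -
    consider "v = w" | "(v, w) \<in> less_of W" | "(w, v) \<in> less_of W"
      using class_order(3)[OF W pts] by blast
    then show ?thesis
    proof cases
      case 1 then show ?thesis using pts by (simp add: last_difference_def distance_self)
    next
      case 2 then show ?thesis using branches_of_ordered_points(1)[OF W l] pts p by simp
    next
      case 3 then show ?thesis
        using branches_of_ordered_points(1)[OF W l 3] pts p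
        by (simp add: last_difference_commute distance_commute)
    qed
  qed
  show "(labelled_point W l v, labelled_point W l w) \<in> less_of cube" if "(v, w) \<in> less_of W" for v w
    using branches_of_ordered_points(2)[OF W l that] class_order(4)[OF W that] p by auto
  show "inj_on (labelled_point W l) (points W)"
  proof (rule inj_onI)
    fix v w assume vw: "v \<in> points W" "w \<in> points W" "labelled_point W l v = labelled_point W l w"
    then have "distance W v w = 0" using dist[OF vw(1,2)] by (simp add: last_difference_def)
    then show "v = w" using Metric_space.zero[OF Metric_space_mspace_mdist vw(1,2)] by simp
  qed
qed

lemma labelled_image_in_copies:
  assumes W: "W \<in> convex_ultrametric_class D" and l: "strict_mono_on (node_ranks D W) l"
    and R: "l ` node_ranks D W \<subseteq> {..R}"
  shows "isomorphic W (substructure cube (labelled_point W l ` points W))"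
    "labelled_point W l ` points W \<subseteq> M"
proof -
  show sub: "labelled_point W l ` points W \<subseteq> M" using labelled_point(1)[OF R] by auto
  have "isomorphism (labelled_point W l) W (substructure cube (labelled_point W l ` points W))"
    unfolding isomorphism_def
    using labelled_point_embedding[OF assms] sub
    by (auto simp: substructure_def bij_betw_def Int_absorb2)
  then show "isomorphic W (substructure cube (labelled_point W l ` points W))"
    unfolding isomorphic_def by blast
qed

text \<open>Composing the copy of \<open>X\<close> with the inverse of the labelled embedding of \<open>Y\<close> gives an embedding
  \<open>e\<close> of \<open>X\<close> into \<open>Y\<close>. Its action \<open>\<phi>\<close> on nodes pulls the labelling of \<open>Y\<close> back to the labelling
  \<open>l \<circ> \<phi>\<close> of \<open>X\<close>, whose branch at \<open>x\<close> is by construction the branch of \<open>Y\<close> at \<open>e x\<close>.\<close>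

lemma copy_inside_labelled_image:
  assumes X: "X \<in> convex_ultrametric_class D" and Y: "Y \<in> convex_ultrametric_class D"
    and l: "strict_mono_on (node_ranks D Y) l" and R: "l ` node_ranks D Y \<subseteq> {..R}"
    and B: "B \<subseteq> labelled_point Y l ` points Y" and iso: "isomorphic X (substructure cube B)"
  obtains l' where "strict_mono_on (node_ranks D X) l'"
    "l' ` node_ranks D X \<subseteq> l ` node_ranks D Y" "B = labelled_point X l' ` points X"
proof -
  let ?p = "labelled_point Y l"
  note emb = labelled_point_embedding[OF Y l R]
  have BM: "B \<subseteq> M" using B labelled_point(1)[OF R] by auto
  obtain f where "isomorphism f X (substructure cube B)"
    using iso unfolding isomorphic_def by blast
  then have bij: "bij_betw f (points X) B"
    and dist_f: "\<forall>x\<in>points X. \<forall>y\<in>points X. distance cube (f x) (f y) = distance X x y"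
    and less_f: "\<forall>x\<in>points X. \<forall>y\<in>points X. (x, y) \<in> less_of X \<longrightarrow> (f x, f y) \<in> less_of cube"
    using BM by (auto simp: isomorphism_def substructure_def Int_absorb2)
  have f: "bij_betw f (points X) B"
    "\<And>x y. x \<in> points X \<Longrightarrow> y \<in> points X \<Longrightarrow> distance cube (f x) (f y) = distance X x y"
    "\<And>x y. (x, y) \<in> less_of X \<Longrightarrow> (f x, f y) \<in> less_of cube"
    using bij dist_f less_f class_order(4)[OF X] by blast+
  define e where "e = inv_into (points Y) ?p \<circ> f"
  have fB: "f x \<in> ?p ` points Y" if "x \<in> points X" for x
    using f(1) B that by (auto simp: bij_betw_def)
  have e: "e x \<in> points Y" "?p (e x) = f x" if "x \<in> points X" for x
    using fB[OF that] by (simp_all add: e_def inv_into_into f_inv_into_f)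
  have dist: "distance Y (e x) (e y) = distance X x y" if "x \<in> points X" "y \<in> points X" for x y
    using f(2)[OF that] emb(1)[of "e x" "e y"] e that by simp
  have up: "(e x, e y) \<in> less_of Y" if "(x, y) \<in> less_of X" for x y
  proof -
    have pts: "x \<in> points X" "y \<in> points X" using class_order(4)[OF X that] by auto
    have fxy: "(f x, f y) \<in> less_of cube" by (rule f(3)[OF that])
    have "e x \<noteq> e y" using fxy class_order(2)[OF cube_in_class] e(2) pts by metis
    moreover have "(e y, e x) \<notin> less_of Y"
      using emb(2)[of "e y" "e x"] fxy e(2) pts class_order(1,2)[OF cube_in_class] by metis
    ultimately show ?thesis using class_order(3)[OF Y] e(1) pts by blast
  qed
  have less: "(x, y) \<in> less_of X \<longleftrightarrow> x \<in> points X \<and> y \<in> points X \<and> (e x, e y) \<in> less_of Y" for x y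
    using up[of x y] up[of y x] class_order(3,4)[OF X, of x y] class_order(1,2)[OF Y] by blast
  obtain \<phi> where \<phi>: "strict_mono_on (node_ranks D X) \<phi>"
    "\<And>x d. x \<in> points X \<Longrightarrow> d \<in> D \<Longrightarrow> \<phi> (level_rank D X x d) = level_rank D Y (e x) d"
    using embedding_of_node_ranks[OF X Y finite_D e(1) dist less] by blast
  have \<phi>N: "\<phi> ` node_ranks D X \<subseteq> node_ranks D Y"
    using e(1) \<phi>(2) level_rank_in_node_ranks[of _ Y _ D] by (auto simp: node_ranks_def[of D X])
  have "strict_mono_on (node_ranks D X) (l \<circ> \<phi>)"
  proof (rule strict_mono_onI)
    fix r s assume "r \<in> node_ranks D X" "s \<in> node_ranks D X" "r < s"
    then show "(l \<circ> \<phi>) r < (l \<circ> \<phi>) s"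
      using strict_mono_onD[OF \<phi>(1)] strict_mono_onD[OF l] \<phi>N by (auto simp: image_subset_iff)
  qed
  moreover have "(l \<circ> \<phi>) ` node_ranks D X \<subseteq> l ` node_ranks D Y" using \<phi>N by auto
  moreover have "B = labelled_point X (l \<circ> \<phi>) ` points X"
  proof -
    have "branch X (l \<circ> \<phi>) x = branch Y l (e x)" if "x \<in> points X" for x
      using \<phi>(2) that by (auto simp: branch_def)
    then have "labelled_point X (l \<circ> \<phi>) x = f x" if "x \<in> points X" for x
      using e(2) that by (simp add: labelled_point_def)
    then show ?thesis using f(1) by (simp add: bij_betw_def)
  qed
  ultimately show thesis using that by blast
qed

lemma labelled_point_cong:
  assumes "\<And>r. r \<in> node_ranks D W \<Longrightarrow> l r = l' r" "w \<in> points W"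
  shows "labelled_point W l w = labelled_point W l' w"
proof -
  have "branch W l w = branch W l' w"
    using assms by (force simp: branch_def node_ranks_def)
  then show ?thesis by (simp add: labelled_point_def)
qed

text \<open>Each set \<open>J\<close> of labels receives the colour of the copy of \<open>X\<close> that it labels. A set \<open>H\<close> that is
  homogeneous for this colouring labels a copy of \<open>Y\<close>, and every copy of \<open>X\<close> inside it comes from
  a subset of \<open>H\<close>.\<close>

lemma monochromatic_copy_in_cube:
  fixes X Y :: "'a ordered_metric"
  assumes X: "X \<in> convex_ultrametric_class D" and Y: "Y \<in> convex_ultrametric_class D"
    and partn: "partn_lst {..<R} (replicate k (card (node_ranks D Y))) (card (node_ranks D X))"
    and \<kappa>: "\<kappa> \<in> copies cube X \<rightarrow> {0..<k}"
  shows "\<exists>Y'\<in>copies cube Y. \<kappa> constant_on copies Y' X"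
proof -
  let ?N = "\<lambda>W. node_ranks D W"
  note finite_X = finite_node_ranks[OF X finite_D] and finite_Y = finite_node_ranks[OF Y finite_D]
  define image_of where "image_of W l = labelled_point W l ` points W" for W :: "'a ordered_metric" and l
  define colour where "colour J = \<kappa> (substructure cube (image_of X (increasing_labelling (?N X) J)))" for J
  have "colour J < k" if J: "J \<in> nsets {..<R} (card (?N X))" for J
  proof -
    have J': "finite J" "card (?N X) = card J" "J \<subseteq> {..R}" using J by (auto simp: nsets_def)
    note lab = increasing_labelling[OF finite_X J'(1,2)]
    have "substructure cube (image_of X (increasing_labelling (?N X) J)) \<in> copies cube X"
      using labelled_image_in_copies[OF X lab(1)] lab(2) J'(3) by (auto simp: copies_def image_of_def)
    then have "colour J \<in> {0..<k}" unfolding colour_def by (rule funcset_mem[OF \<kappa>])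
    then show ?thesis by simp
  qed
  then have "colour \<in> nsets {..<R} (card (?N X)) \<rightarrow> {..<k}" by auto
  then obtain i H where "H \<in> nsets {..<R} (card (?N Y))"
    and mono: "colour ` nsets H (card (?N X)) \<subseteq> {i}"
    by (rule partn_lstE[OF partn]) auto
  then have H: "finite H" "card (?N Y) = card H" "H \<subseteq> {..R}" by (auto simp: nsets_def)
  note lab = increasing_labelling[OF finite_Y H(1,2)]
  let ?l = "increasing_labelling (?N Y) H"
  have R: "?l ` ?N Y \<subseteq> {..R}" using lab(2) H(3) by simp
  have "\<kappa> Q = i" if Q: "Q \<in> copies (substructure cube (image_of Y ?l)) X" for Q
  proof -
    obtain B where B: "B \<subseteq> image_of Y ?l" "Q = substructure (substructure cube (image_of Y ?l)) B"
      "isomorphic X Q"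
      using Q by (auto simp: copies_def substructure_def)
    have QB: "Q = substructure cube B"
    proof -
      have "image_of Y ?l \<inter> B = B" "less_of cube \<inter> image_of Y ?l \<times> image_of Y ?l \<inter> B \<times> B = less_of cube \<inter> B \<times> B"
        using B(1) by auto
      then show ?thesis unfolding B(2) by (simp add: substructure_def)
    qed
    obtain l' where l': "strict_mono_on (?N X) l'" "l' ` ?N X \<subseteq> ?l ` ?N Y"
      "B = labelled_point X l' ` points X"
      using copy_inside_labelled_image[OF X Y lab(1) R] B(1,3) QB by (auto simp: image_of_def)
    define J where "J = l' ` ?N X"
    have J: "finite J" "card (?N X) = card J"
      unfolding J_def using finite_X card_image[OF strict_mono_on_imp_inj_on[OF l'(1)]] by auto
    have "increasing_labelling (?N X) J r = l' r" if "r \<in> ?N X" for r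
      using strict_mono_on_eq_if_image_eq[OF finite_X increasing_labelling(1)[OF finite_X J] l'(1) _ that]
        increasing_labelling(2)[OF finite_X J] by (simp add: J_def)
    then have "image_of X (increasing_labelling (?N X) J) = B"
      unfolding l'(3) image_of_def by (intro image_cong refl labelled_point_cong)
    then have "\<kappa> Q = colour J" by (simp add: colour_def QB)
    moreover have "J \<in> nsets H (card (?N X))"
      using J l'(2) lab(2) by (auto simp: nsets_def J_def)
    ultimately show ?thesis using mono by auto
  qed
  moreover have "substructure cube (image_of Y ?l) \<in> copies cube Y"
    using labelled_image_in_copies[OF Y lab(1) R] by (auto simp: copies_def image_of_def)
  ultimately show ?thesis unfolding constant_on_def by blast
qed

end

lemma convex_ultrametric_class_mono: "D \<subseteq> S \<Longrightarrow> convex_ultrametric_class D \<subseteq> convex_ultrametric_class S"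
  by (auto simp: convex_ultrametric_class_def distances_in_def)

lemma finitely_many_distances:
  assumes "X \<in> convex_ultrametric_class S"
  obtains D where "finite D" "D \<subseteq> S" "X \<in> convex_ultrametric_class D"
proof
  let ?P = "{(x, y) \<in> points X \<times> points X. x \<noteq> y}"
  let ?D = "(\<lambda>(x, y). distance X x y) ` ?P"
  have "finite ?P"
    by (rule finite_subset[of _ "points X \<times> points X"]) (use class_carrier(1)[OF assms] in auto)
  then show "finite ?D" by (rule finite_imageI)
  show "?D \<subseteq> S" using class_carrier(3)[OF assms] by auto
  show "X \<in> convex_ultrametric_class ?D"
    using assms by (auto simp: convex_ultrametric_class_def distances_in_def)
qed

theorem theorem14:
  fixes S :: "real set"
  assumes "S \<subseteq> {0<..}"
    and "infinite (UNIV :: 'a set)"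
  shows "ramsey_property (convex_ultrametric_class S :: 'a ordered_metric set)"
  unfolding ramsey_property_def
proof (intro ballI allI impI)
  fix X Y :: "'a ordered_metric" and k :: nat
  assume X: "X \<in> convex_ultrametric_class S" and Y: "Y \<in> convex_ultrametric_class S"
  obtain D\<^sub>X D\<^sub>Y where D\<^sub>X: "finite D\<^sub>X" "D\<^sub>X \<subseteq> S" "X \<in> convex_ultrametric_class D\<^sub>X"
    and D\<^sub>Y: "finite D\<^sub>Y" "D\<^sub>Y \<subseteq> S" "Y \<in> convex_ultrametric_class D\<^sub>Y"
    using finitely_many_distances X Y by metis
  define D where "D = D\<^sub>X \<union> D\<^sub>Y"
  have D: "finite D" "D \<subseteq> S" "X \<in> convex_ultrametric_class D" "Y \<in> convex_ultrametric_class D"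
    using D\<^sub>X D\<^sub>Y convex_ultrametric_class_mono[of _ D] by (auto simp: D_def)
  obtain R :: nat where R:
    "partn_lst {..<R} (replicate k (card (node_ranks D Y))) (card (node_ranks D X))"
    using ramsey_full by blast
  obtain M :: "'a set" where M: "finite M" "card M = card (D \<rightarrow>\<^sub>E {..R})"
    using infinite_arbitrarily_large[OF assms(2)] by blast
  obtain code where "bij_betw code M (D \<rightarrow>\<^sub>E {..R})"
    using finite_same_card_bij[OF M(1) _ M(2)] finite_PiE[OF D(1), of "\<lambda>_. {..R}"] by auto
  then interpret lexicographic_cube D R M code
    by unfold_locales (use D assms(1) in auto)
  show "\<exists>Z\<in>convex_ultrametric_class S. \<forall>\<kappa> :: 'a ordered_metric \<Rightarrow> nat.
      \<kappa> \<in> copies Z X \<rightarrow> {0..<k} \<longrightarrow> (\<exists>Y'\<in>copies Z Y. \<kappa> constant_on copies Y' X)"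
    using cube_in_class convex_ultrametric_class_mono[OF D(2)]
      monochromatic_copy_in_cube[OF D(3,4) R] by blast
qed

end
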